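(* For $i=1,2$, let $\mathcal{G}_{i}=(G,(K_{v}^{i})_{v\in V},(\phi_{e}^{i})_{e\in E})$ be two Mauldin-Williams graphs over the same underlying graph $G=(V,E,r,s)$. Let $K^i=\coprod_{v\in V}K^i_v$, $A_{i}=C(K^{i})$, and let $\mathcal{X}_{i}$ be the associated $C^{*}$-correspondence over $A_i$. Suppose there are a homeomorphism $f:K^{1}\rightarrow K^{2}$, a partition $\{U_{1},\dots,U_{m}\}$ of $K^{1}$ into open subsets, for some $m\in\mathbb{N}$, and for each $j\in\{1,\dots,m\}$ a permutation $\sigma_{j}$ of $E$, such that for all $e\in E$ and $j\in\{1,\dots,m\}$, $$f(K_{r(e)}^{1})=K_{r(\sigma_{j}(e))}^{2}\quad\text{and}\quad f^{-1}\circ\phi_{\sigma_{j}(e)}^{2}\circ f|_{U_{j}}=\phi_{e}^{1}|_{U_{j}},$$ the last equality being one of maps on $U_j\cap K^1_{r(e)}$. Then $\mathcal{X}_{1}$ and $\mathcal{X}_{2}$ are isomorphic as $C^*$-correspondences.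
   Context: Mauldin-Williams graph: a system $\mathcal{G}=(G,(K_v)_{v\in V},(\phi_e)_{e\in E})$ where $G=(V,E,r,s)$ is a directed graph with finite vertex set $V$, finite edge set $E$, and surjective range and source maps $r,s:E\to V$ (no sinks, no sources); each $K_v$ is a nonempty compact metric space with metric $\rho_v$; and for each $e\in E$, $\phi_e:K_{r(e)}\to K_{s(e)}$ is a map with $c_1\rho_{r(e)}(x,y)\le\rho_{s(e)}(\phi_e(x),\phi_e(y))\le c\,\rho_{r(e)}(x,y)$ for all $x,y\in K_{r(e)}$, for constants $0<c_1\le c<1$ independent of $e$. Standing assumption: $(K_v)_{v\in V}$ is the invariant list of $\mathcal G$, i.e. $K_v=\bigcup_{e\in E,\,s(e)=v}\phi_e(K_{r(e)})$ for every $v\in V$. Write $K=\coprod_{v\in V}K_v$ (disjoint union). Associated correspondence: let $E\times_G K=\{(e,x): e\in E,\ x\in K_{r(e)}\}$ (a compact space) and $A=C(K)$. The $C^*$-correspondence $\mathcal X$ over $A$ associated with $\mathcal G$ is $\mathcal X=C(E\times_G K)$ with $(\xi\cdot a)(e,x)=\xi(e,x)a(x)$, $(a\cdot\xi)(e,x)=a(\phi_e(x))\xi(e,x)$ and $\langle\xi,\eta\rangle_A(x)=\sum_{e\in E,\,x\in K_{r(e)}}\overline{\xi(e,x)}\eta(e,x)$. Isomorphism of correspondences: $\mathcal X_1$ over $A_1$ and $\mathcal X_2$ over $A_2$ are isomorphic as $C^*$-correspondences if there are a $*$-isomorphism $\alpha:A_1\to A_2$ and a surjective linear map $V:\mathcal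 X_1\to\mathcal X_2$ with $V(a\xi b)=\alpha(a)V(\xi)\alpha(b)$ and $\langle V\xi,V\eta\rangle_{A_2}=\alpha(\langle\xi,\eta\rangle_{A_1})$. *)

theory Defs
  imports "HOL-Analysis.Analysis" "HOL-Library.Disjoint_Sets" "Graph_Theory.Digraph"
begin

section \<open>Mauldin-Williams graphs\<close>

text \<open>
  The source and range maps of \<open>G\<close> are \<open>tail G\<close> and \<open>head G\<close>. All \<open>K v\<close> are metric spaces on
  subsets of one type \<open>'a\<close>, with a metric depending on \<open>v\<close>; they may overlap as subsets of \<open>'a\<close>.
\<close>

locale mauldin_williams_graph = fin_digraph G
  for G :: "('v, 'e) pre_digraph"
    and K :: "'v \<Rightarrow> 'a metric"
    and \<phi> :: "'e \<Rightarrow> 'a \<Rightarrow> 'a" +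
  assumes source_surj: "tail G ` arcs G = verts G"
    and range_surj: "head G ` arcs G = verts G"
    and space_nonempty: "v \<in> verts G \<Longrightarrow> mspace (K v) \<noteq> {}"
    and space_compact: "v \<in> verts G \<Longrightarrow> compact_space (mtopology_of (K v))"
    and edge_map_into: "e \<in> arcs G \<Longrightarrow> \<phi> e \<in> mspace (K (head G e)) \<rightarrow> mspace (K (tail G e))"
    and bi_lipschitz:
      "\<exists>c1 c. 0 < c1 \<and> c1 \<le> c \<and> c < 1 \<and>
         (\<forall>e\<in>arcs G. \<forall>x\<in>mspace (K (head G e)). \<forall>y\<in>mspace (K (head G e)).
            c1 * mdist (K (head G e)) x y \<le> mdist (K (tail G e)) (\<phi> e x) (\<phi> e y) \<and>
            mdist (K (tail G e)) (\<phi> e x) (\<phi> e y) \<le> c * mdist (K (head G e)) x y)"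

definition invariant_list ::
    "('v, 'e) pre_digraph \<Rightarrow> ('v \<Rightarrow> 'a metric) \<Rightarrow> ('e \<Rightarrow> 'a \<Rightarrow> 'a) \<Rightarrow> bool" where
  "invariant_list G K \<phi> \<longleftrightarrow>
     (\<forall>v\<in>verts G. mspace (K v) = (\<Union>e\<in>{e \<in> arcs G. tail G e = v}. \<phi> e ` mspace (K (head G e))))"

text \<open>A point of the disjoint union of the \<open>K v\<close> is a pair \<open>(v, x)\<close> with \<open>x\<close> in \<open>K v\<close>.\<close>

definition total_space :: "('v, 'e) pre_digraph \<Rightarrow> ('v \<Rightarrow> 'a metric) \<Rightarrow> ('v \<times> 'a) topology" where
  "total_space G K = sum_topology (\<lambda>v. mtopology_of (K v)) (verts G)"

definition fibre :: "('v \<Rightarrow> 'a metric) \<Rightarrow> 'v \<Rightarrow> ('v \<times> 'a) set" where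
  "fibre K v = {v} \<times> mspace (K v)"

text \<open>The map \<open>\<phi> e\<close>, regarded as a map between subsets of the disjoint union.\<close>

definition edge_map ::
    "('v, 'e) pre_digraph \<Rightarrow> ('e \<Rightarrow> 'a \<Rightarrow> 'a) \<Rightarrow> 'e \<Rightarrow> 'v \<times> 'a \<Rightarrow> 'v \<times> 'a" where
  "edge_map G \<phi> e p = (tail G e, \<phi> e (snd p))"

definition edge_space ::
    "('v, 'e) pre_digraph \<Rightarrow> ('v \<Rightarrow> 'a metric) \<Rightarrow> ('e \<times> 'v \<times> 'a) topology" where
  "edge_space G K =
     subtopology (prod_topology (discrete_topology (arcs G)) (total_space G K))
       {(e, p). e \<in> arcs G \<and> p \<in> fibre K (head G e)}"

section \<open>Correspondences and their isomorphisms\<close>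

text \<open>
  The records hold the operations only, as in HOL-Algebra. Norms are not recorded, since
  isomorphisms are defined by the algebraic operations and the inner product.
\<close>

record 'a star_algebra =
  alg_carrier :: "'a set"
  alg_add :: "'a \<Rightarrow> 'a \<Rightarrow> 'a"
  alg_scale :: "complex \<Rightarrow> 'a \<Rightarrow> 'a"
  alg_mult :: "'a \<Rightarrow> 'a \<Rightarrow> 'a"
  alg_star :: "'a \<Rightarrow> 'a"

record ('a, 'x) correspondence =
  coeff_alg :: "'a star_algebra"
  vec_carrier :: "'x set"
  vec_add :: "'x \<Rightarrow> 'x \<Rightarrow> 'x"
  vec_scale :: "complex \<Rightarrow> 'x \<Rightarrow> 'x"
  left_act :: "'a \<Rightarrow> 'x \<Rightarrow> 'x"
  right_act :: "'x \<Rightarrow> 'a \<Rightarrow> 'x"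
  inner_prod :: "'x \<Rightarrow> 'x \<Rightarrow> 'a"

definition star_isomorphism :: "'a star_algebra \<Rightarrow> 'b star_algebra \<Rightarrow> ('a \<Rightarrow> 'b) \<Rightarrow> bool" where
  "star_isomorphism A B \<alpha> \<longleftrightarrow>
     bij_betw \<alpha> (alg_carrier A) (alg_carrier B) \<and>
     (\<forall>a\<in>alg_carrier A. \<forall>b\<in>alg_carrier A. \<alpha> (alg_add A a b) = alg_add B (\<alpha> a) (\<alpha> b)) \<and>
     (\<forall>c. \<forall>a\<in>alg_carrier A. \<alpha> (alg_scale A c a) = alg_scale B c (\<alpha> a)) \<and>
     (\<forall>a\<in>alg_carrier A. \<forall>b\<in>alg_carrier A. \<alpha> (alg_mult A a b) = alg_mult B (\<alpha> a) (\<alpha> b)) \<and>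
     (\<forall>a\<in>alg_carrier A. \<alpha> (alg_star A a) = alg_star B (\<alpha> a))"

definition correspondence_isomorphism ::
    "('a, 'x) correspondence \<Rightarrow> ('b, 'y) correspondence \<Rightarrow> ('a \<Rightarrow> 'b) \<Rightarrow> ('x \<Rightarrow> 'y) \<Rightarrow> bool" where
  "correspondence_isomorphism X Y \<alpha> V \<longleftrightarrow>
     star_isomorphism (coeff_alg X) (coeff_alg Y) \<alpha> \<and>
     V ` vec_carrier X = vec_carrier Y \<and>
     (\<forall>\<xi>\<in>vec_carrier X. \<forall>\<eta>\<in>vec_carrier X. V (vec_add X \<xi> \<eta>) = vec_add Y (V \<xi>) (V \<eta>)) \<and>
     (\<forall>c. \<forall>\<xi>\<in>vec_carrier X. V (vec_scale X c \<xi>) = vec_scale Y c (V \<xi>)) \<and>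
     (\<forall>a\<in>alg_carrier (coeff_alg X). \<forall>b\<in>alg_carrier (coeff_alg X). \<forall>\<xi>\<in>vec_carrier X.
        V (right_act X (left_act X a \<xi>) b) = right_act Y (left_act Y (\<alpha> a) (V \<xi>)) (\<alpha> b)) \<and>
     (\<forall>\<xi>\<in>vec_carrier X. \<forall>\<eta>\<in>vec_carrier X.
        inner_prod Y (V \<xi>) (V \<eta>) = \<alpha> (inner_prod X \<xi> \<eta>))"

definition isomorphic_correspondences ::
    "('a, 'x) correspondence \<Rightarrow> ('b, 'y) correspondence \<Rightarrow> bool" where
  "isomorphic_correspondences X Y \<longleftrightarrow> (\<exists>\<alpha> V. correspondence_isomorphism X Y \<alpha> V)"

section \<open>The correspondence of a Mauldin-Williams graph\<close>

text \<open>
  Functions on a space are extensional (\<open>undefined\<close> off the space), so that equality of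
  elements of \<open>C(X)\<close> is equality in HOL.
\<close>

definition cont_functions :: "'p topology \<Rightarrow> ('p \<Rightarrow> complex) set" where
  "cont_functions X = {a. continuous_map X euclidean a} \<inter> extensional (topspace X)"

definition function_algebra :: "'p topology \<Rightarrow> ('p \<Rightarrow> complex) star_algebra" where
  "function_algebra X =
     \<lparr> alg_carrier = cont_functions X,
       alg_add = (\<lambda>a b. \<lambda>x\<in>topspace X. a x + b x),
       alg_scale = (\<lambda>c a. \<lambda>x\<in>topspace X. c * a x),
       alg_mult = (\<lambda>a b. \<lambda>x\<in>topspace X. a x * b x),
       alg_star = (\<lambda>a. \<lambda>x\<in>topspace X. cnj (a x)) \<rparr>"

definition mw_correspondence ::
    "('v, 'e) pre_digraph \<Rightarrow> ('v \<Rightarrow> 'a metric) \<Rightarrow> ('e \<Rightarrow> 'a \<Rightarrow> 'a) \<Rightarrow>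
      ('v \<times> 'a \<Rightarrow> complex, 'e \<times> 'v \<times> 'a \<Rightarrow> complex) correspondence" where
  "mw_correspondence G K \<phi> =
     \<lparr> coeff_alg = function_algebra (total_space G K),
       vec_carrier = cont_functions (edge_space G K),
       vec_add = (\<lambda>\<xi> \<eta>. \<lambda>z\<in>topspace (edge_space G K). \<xi> z + \<eta> z),
       vec_scale = (\<lambda>c \<xi>. \<lambda>z\<in>topspace (edge_space G K). c * \<xi> z),
       left_act = (\<lambda>a \<xi>. \<lambda>(e, p)\<in>topspace (edge_space G K). a (edge_map G \<phi> e p) * \<xi> (e, p)),
       right_act = (\<lambda>\<xi> a. \<lambda>(e, p)\<in>topspace (edge_space G K). \<xi> (e, p) * a p),
       inner_prod = (\<lambda>\<xi> \<eta>. \<lambda>p\<in>topspace (total_space G K).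
         \<Sum>e\<in>{e \<in> arcs G. p \<in> fibre K (head G e)}. cnj (\<xi> (e, p)) * \<eta> (e, p)) \<rparr>"

end

theory Submission
  imports Defs
begin

text \<open>
  Let \<open>s p = \<sigma> j\<close> for \<open>p\<close> in \<open>U j\<close>. Since the \<open>U j\<close> are open, \<open>s\<close> is locally constant, so
  \<open>(e, p) \<mapsto> (s p e, f p)\<close> is a homeomorphism between the edge spaces that covers \<open>f\<close>. Pulling
  functions back along its inverse and along the inverse of \<open>f\<close> gives the isomorphism: the
  conjugacy relation makes the pullback respect the left actions, and the inner products agree
  because \<open>s p\<close> only permutes the summands over \<open>p\<close>.
\<close>

section \<open>Locally constant maps and pullbacks of continuous functions\<close>

lemma continuous_map_discrete_locally_constant:
  assumes "t \<in> topspace X \<rightarrow> A"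
    and "\<And>x. x \<in> topspace X \<Longrightarrow> \<exists>W. openin X W \<and> x \<in> W \<and> (\<forall>y\<in>W. t y = t x)"
  shows "continuous_map X (discrete_topology A) t"
proof -
  have "openin X {x \<in> topspace X. t x \<in> S}" for S
  proof (subst openin_subopen, intro ballI)
    fix x assume x: "x \<in> {x \<in> topspace X. t x \<in> S}"
    with assms(2) obtain W where "openin X W" "x \<in> W" "\<forall>y\<in>W. t y = t x" by blast
    have "W \<subseteq> {x \<in> topspace X. t x \<in> S}"
    proof
      fix y assume "y \<in> W"
      then have "y \<in> topspace X" "t y = t x"
        using openin_subset[OF \<open>openin X W\<close>] \<open>\<forall>y\<in>W. t y = t x\<close> by blast+
      with x show "y \<in> {x \<in> topspace X. t x \<in> S}" by simp
    qed
    with \<open>openin X W\<close> \<open>x \<in> W\<close>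
    show "\<exists>T. openin X T \<and> x \<in> T \<and> T \<subseteq> {x \<in> topspace X. t x \<in> S}" by blast
  qed
  with assms(1) show ?thesis by (auto simp: continuous_map_def)
qed

lemma cont_functions_pullback:
  assumes "continuous_map Y X h" and "a \<in> cont_functions X"
  shows "(\<lambda>y\<in>topspace Y. a (h y)) \<in> cont_functions Y"
proof -
  have "continuous_map Y euclidean (a \<circ> h)"
    using assms by (auto simp: cont_functions_def intro: continuous_map_compose)
  then have "continuous_map Y euclidean (\<lambda>y\<in>topspace Y. a (h y))"
    by (rule continuous_map_eq) auto
  then show ?thesis by (simp add: cont_functions_def)
qed

text \<open>On \<open>X\<close> this is \<open>g (f x) = x\<close>; off \<open>X\<close> both sides
  are \<open>undefined\<close>, because \<open>a\<close> is extensional. Used in both directions, it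
  makes the two pullbacks mutually inverse.\<close>

lemma pullback_pullback:
  assumes "homeomorphic_maps X Y f g" and "a \<in> cont_functions X"
  shows "(\<lambda>x\<in>topspace X. (\<lambda>y\<in>topspace Y. a (g y)) (f x)) = a"
  using assms
  by (auto simp: fun_eq_iff homeomorphic_maps_def cont_functions_def extensional_def
      dest: continuous_map_funspace)

lemma pullback_bij_betw:
  assumes "homeomorphic_maps X Y f g"
  shows "bij_betw (\<lambda>a. \<lambda>y\<in>topspace Y. a (g y)) (cont_functions X) (cont_functions Y)"
proof (rule bij_betw_byWitness[where f' = "\<lambda>b. \<lambda>x\<in>topspace X. b (f x)"])
  have cont: "continuous_map X Y f" "continuous_map Y X g" and sym: "homeomorphic_maps Y X g f"
    using assms by (auto simp: homeomorphic_maps_def)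
  show "\<forall>a\<in>cont_functions X. (\<lambda>x\<in>topspace X. (\<lambda>y\<in>topspace Y. a (g y)) (f x)) = a"
    using pullback_pullback[OF assms] by blast
  show "\<forall>b\<in>cont_functions Y. (\<lambda>y\<in>topspace Y. (\<lambda>x\<in>topspace X. b (f x)) (g y)) = b"
    using pullback_pullback[OF sym] by blast
  show "(\<lambda>a. \<lambda>y\<in>topspace Y. a (g y)) ` cont_functions X \<subseteq> cont_functions Y"
    using cont_functions_pullback[OF cont(2)] by blast
  show "(\<lambda>b. \<lambda>x\<in>topspace X. b (f x)) ` cont_functions Y \<subseteq> cont_functions X"
    using cont_functions_pullback[OF cont(1)] by blast
qed

lemma star_isomorphism_pullback:
  assumes "homeomorphic_maps X Y f g"
  shows "star_isomorphism (function_algebra X) (function_algebra Y) (\<lambda>a. \<lambda>y\<in>topspace Y. a (g y))"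
proof -
  have "g y \<in> topspace X" if "y \<in> topspace Y" for y
    using assms that by (auto simp: homeomorphic_maps_def dest: continuous_map_funspace)
  then show ?thesis
    using pullback_bij_betw[OF assms]
    by (auto simp: star_isomorphism_def function_algebra_def fun_eq_iff)
qed

section \<open>Points and continuous maps of edge spaces\<close>

lemma topspace_total_space: "topspace (total_space G K) = (\<Union>v\<in>verts G. fibre K v)"
  by (auto simp: total_space_def fibre_def)

lemma (in wf_digraph) topspace_edge_space:
  "topspace (edge_space G K) = {(e, p). e \<in> arcs G \<and> p \<in> fibre K (head G e)}"
  unfolding edge_space_def topspace_total_space topspace_subtopology topspace_prod_topology
    topspace_discrete_topology
  using head_in_verts by blast

text \<open>The edge component is locally constant and the point component is \<open>f\<close> after
  a projection, so both are continuous. The two systems are kept general so that a twisted map and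
  its inverse are both instances.\<close>

lemma continuous_map_edge_space:
  assumes "wf_digraph G" and "wf_digraph H"
    and f: "continuous_map (total_space G K) (total_space H L) f"
    and s: "\<And>p. p \<in> topspace (total_space G K) \<Longrightarrow>
              \<exists>W. openin (total_space G K) W \<and> p \<in> W \<and> (\<forall>q\<in>W. s q = s p)"
    and sf: "\<And>e p. e \<in> arcs G \<Longrightarrow> p \<in> fibre K (head G e) \<Longrightarrow>
              s p e \<in> arcs H \<and> f p \<in> fibre L (head H (s p e))"
  shows "continuous_map (edge_space G K) (edge_space H L) (\<lambda>(e, p). (s p e, f p))"
proof -
  note top = wf_digraph.topspace_edge_space[OF assms(1)]
  have snd: "continuous_map (edge_space G K) (total_space G K) snd"
    unfolding edge_space_def by (intro continuous_map_from_subtopology continuous_map_snd)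
  have "\<exists>W. openin (edge_space G K) W \<and> z \<in> W \<and>
          (\<forall>y\<in>W. (case y of (e, p) \<Rightarrow> s p e) = (case z of (e, p) \<Rightarrow> s p e))"
    if z: "z \<in> topspace (edge_space G K)" for z
  proof -
    obtain e p where ep: "z = (e, p)" by (cases z)
    have e: "e \<in> arcs G" "p \<in> fibre K (head G e)" using z ep top by auto
    have "p \<in> topspace (total_space G K)"
      using funcset_mem[OF continuous_map_funspace[OF snd] z] ep by simp
    then obtain W where W: "openin (total_space G K) W" "p \<in> W" "\<forall>q\<in>W. s q = s p"
      using s by blast
    \<comment> \<open>The singleton \<open>{e}\<close> is open in the discrete factor and freezes
      the edge, while \<open>W\<close> freezes \<open>s\<close>; hence \<open>s p e\<close> is
      constant on this neighbourhood.\<close>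
    have "openin (edge_space G K)
        (({e} \<times> W) \<inter> {(e, p). e \<in> arcs G \<and> p \<in> fibre K (head G e)})"
      unfolding edge_space_def
      by (intro openin_subtopology_Int) (use W e in \<open>auto simp: openin_prod_Times_iff\<close>)
    moreover have "z \<in> ({e} \<times> W) \<inter> {(e, p). e \<in> arcs G \<and> p \<in> fibre K (head G e)}"
      using W(2) e ep by simp
    moreover have "(case y of (e, p) \<Rightarrow> s p e) = (case z of (e, p) \<Rightarrow> s p e)"
      if y: "y \<in> ({e} \<times> W) \<inter> {(e, p). e \<in> arcs G \<and> p \<in> fibre K (head G e)}" for y
    proof -
      have "s (snd y) = s p" "fst y = e" using W(3) y by auto
      then show ?thesis by (simp add: ep case_prod_unfold)
    qed
    ultimately show ?thesis by blast
  qed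
  then have "continuous_map (edge_space G K) (discrete_topology (arcs H)) (\<lambda>(e, p). s p e)"
    by (intro continuous_map_discrete_locally_constant) (auto simp: top sf)
  moreover have "continuous_map (edge_space G K) (total_space H L) (f \<circ> snd)"
    using snd f by (rule continuous_map_compose)
  ultimately have "continuous_map (edge_space G K)
      (prod_topology (discrete_topology (arcs H)) (total_space H L)) (\<lambda>(e, p). (s p e, f p))"
    by (simp add: continuous_map_pairwise o_def case_prod_unfold)
  then show ?thesis
    unfolding edge_space_def[of H]
    by (auto simp: continuous_map_in_subtopology top sf)
qed

section \<open>The isomorphism induced by a locally constant field of permutations\<close>

text \<open>The partition enters only through the field \<open>s\<close> of permutations attached to
  points. Its fibre condition is an equivalence, so that \<open>s p\<close> matches the edges
  contributing to the inner product at \<open>p\<close> exactly with those contributing at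
  \<open>f p\<close>.\<close>

lemma mw_correspondence_isomorphic_twist:
  assumes wf: "wf_digraph G"
    and homeo: "homeomorphic_maps (total_space G K1) (total_space G K2) f g"
    and perm: "\<And>p. p \<in> topspace (total_space G K1) \<Longrightarrow> s p permutes arcs G"
    and const: "\<And>p. p \<in> topspace (total_space G K1) \<Longrightarrow>
              \<exists>W. openin (total_space G K1) W \<and> p \<in> W \<and> (\<forall>q\<in>W. s q = s p)"
    and fib: "\<And>e p. e \<in> arcs G \<Longrightarrow> p \<in> topspace (total_space G K1) \<Longrightarrow>
              f p \<in> fibre K2 (head G (s p e)) \<longleftrightarrow> p \<in> fibre K1 (head G e)"
    and into: "\<And>e. e \<in> arcs G \<Longrightarrow> \<phi>2 e \<in> mspace (K2 (head G e)) \<rightarrow> mspace (K2 (tail G e))"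
    and conj: "\<And>e p. e \<in> arcs G \<Longrightarrow> p \<in> fibre K1 (head G e) \<Longrightarrow>
              g (edge_map G \<phi>2 (s p e) (f p)) = edge_map G \<phi>1 e p"
  shows "isomorphic_correspondences (mw_correspondence G K1 \<phi>1) (mw_correspondence G K2 \<phi>2)"
proof -
  interpret wf_digraph G by (rule wf)
  let ?T1 = "topspace (total_space G K1)" and ?T2 = "topspace (total_space G K2)"
  have cont: "continuous_map (total_space G K1) (total_space G K2) f"
      "continuous_map (total_space G K2) (total_space G K1) g"
    and gf: "\<And>p. p \<in> ?T1 \<Longrightarrow> g (f p) = p" and fg: "\<And>q. q \<in> ?T2 \<Longrightarrow> f (g q) = q"
    using homeo by (auto simp: homeomorphic_maps_def)
  have fT: "f p \<in> ?T2" if "p \<in> ?T1" for p using continuous_map_funspace[OF cont(1)] that by auto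
  have gT: "g q \<in> ?T1" if "q \<in> ?T2" for q using continuous_map_funspace[OF cont(2)] that by auto
  have T1: "p \<in> ?T1" if "e \<in> arcs G" "p \<in> fibre K1 (head G e)" for e p
    using that by (auto simp: topspace_total_space)
  have T2: "q \<in> ?T2" if "e \<in> arcs G" "q \<in> fibre K2 (head G e)" for e q
    using that by (auto simp: topspace_total_space)
  \<comment> \<open>\<open>t\<close> is the inverse field, indexed by points of the second space; it
    makes \<open>h\<close> below the inverse of \<open>k\<close>.\<close>
  define t where "t q = inv (s (g q))" for q
  have t: "t q permutes arcs G" "s (g q) (t q e) = e" "t q (s (g q) e) = e" if "q \<in> ?T2" for q e
    using perm[OF gT[OF that]]
    by (auto simp: t_def permutes_inv permutes_inverses)
  have t_arcs: "t q e \<in> arcs G" if "q \<in> ?T2" "e \<in> arcs G" for q e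
    using t(1)[OF that(1)] that(2) by (simp add: permutes_in_image)
  have fib': "g q \<in> fibre K1 (head G (t q e)) \<longleftrightarrow> q \<in> fibre K2 (head G e)"
    if "e \<in> arcs G" "q \<in> ?T2" for e q
    using fib[OF t_arcs[OF that(2,1)] gT[OF that(2)]] t(2) fg that by simp
  define k where "k = (\<lambda>(e, p). (s p e, f p))"
  define h where "h = (\<lambda>(e, q). (t q e, g q))"
  have contk: "continuous_map (edge_space G K1) (edge_space G K2) k"
    unfolding k_def using T1 fib perm
    by (intro continuous_map_edge_space wf cont const) (auto simp: permutes_in_image)
  have "\<exists>W. openin (total_space G K2) W \<and> q \<in> W \<and> (\<forall>q'\<in>W. t q' = t q)" if q: "q \<in> ?T2" for q
  proof -
    obtain W where W: "openin (total_space G K1) W" "g q \<in> W" "\<forall>p\<in>W. s p = s (g q)"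
      using const[OF gT[OF q]] by blast
    \<comment> \<open>\<open>t q\<close> depends on \<open>q\<close> only through
      \<open>s (g q)\<close>, so the preimage under \<open>g\<close> of a set where \<open>s\<close>
      is constant serves as the neighbourhood.\<close>
    have "openin (total_space G K2) {x \<in> ?T2. g x \<in> W}"
      using cont(2) W(1) by (rule openin_continuous_map_preimage)
    moreover have "\<forall>q'\<in>{x \<in> ?T2. g x \<in> W}. t q' = t q"
    proof
      fix q' assume "q' \<in> {x \<in> ?T2. g x \<in> W}"
      then have "s (g q') = s (g q)" using W(3) by blast
      then show "t q' = t q" by (simp only: t_def)
    qed
    ultimately show ?thesis using W(2) q by blast
  qed
  then have conth: "continuous_map (edge_space G K2) (edge_space G K1) h"
    unfolding h_def using T2 fib' t_arcs
    by (intro continuous_map_edge_space wf cont) auto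
  have edge: "homeomorphic_maps (edge_space G K1) (edge_space G K2) k h"
    unfolding homeomorphic_maps_def
  proof (intro conjI contk conth ballI)
    show "h (k z) = z" if z: "z \<in> topspace (edge_space G K1)" for z
    proof -
      obtain e p where ep: "z = (e, p)" "e \<in> arcs G" "p \<in> fibre K1 (head G e)"
        using z by (auto simp: topspace_edge_space)
      then have p: "p \<in> ?T1" by (intro T1)
      show ?thesis using t(3)[OF fT[OF p], of e] by (simp add: gf[OF p] ep h_def k_def)
    qed
    show "k (h z) = z" if z: "z \<in> topspace (edge_space G K2)" for z
    proof -
      obtain e q where eq: "z = (e, q)" "e \<in> arcs G" "q \<in> fibre K2 (head G e)"
        using z by (auto simp: topspace_edge_space)
      then have q: "q \<in> ?T2" by (intro T2)
      show ?thesis using t(2)[OF q, of e] by (simp add: fg[OF q] eq h_def k_def)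
    qed
  qed
  have hE: "h z \<in> topspace (edge_space G K1)" if "z \<in> topspace (edge_space G K2)" for z
    using continuous_map_funspace[OF conth] that by (rule funcset_mem)
  \<comment> \<open>This is \<open>conj\<close> at the edge \<open>t q e\<close> and the point
    \<open>g q\<close>, which \<open>s (g q)\<close> and \<open>f\<close> carry back to
    \<open>e\<close> and \<open>q\<close>. Membership in \<open>?T2\<close> matters because the
    pullback of a coefficient function is \<open>undefined\<close> elsewhere.\<close>
  have emap: "edge_map G \<phi>2 e q \<in> ?T2 \<and> g (edge_map G \<phi>2 e q) = edge_map G \<phi>1 (t q e) (g q)"
    if "e \<in> arcs G" "q \<in> fibre K2 (head G e)" for e q
  proof
    show "edge_map G \<phi>2 e q \<in> ?T2"
      using into[OF that(1)] that by (auto simp: edge_map_def fibre_def topspace_total_space)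
    have q: "q \<in> ?T2" using that by (rule T2)
    then show "g (edge_map G \<phi>2 e q) = edge_map G \<phi>1 (t q e) (g q)"
      using conj[of "t q e" "g q"] fib' t_arcs t(2) fg that by simp
  qed
  have inner: "(\<Sum>e\<in>{e \<in> arcs G. q \<in> fibre K2 (head G e)}. F (t q e)) =
      (\<Sum>e\<in>{e \<in> arcs G. g q \<in> fibre K1 (head G e)}. F e)"
    if q: "q \<in> ?T2" for q and F :: "_ \<Rightarrow> complex"
  \<comment> \<open>The reindexing \<open>t q\<close> of the summands over \<open>q\<close> has
    inverse \<open>s (g q)\<close>; \<open>fib\<close> and \<open>fib'\<close> show that the two
    index sets correspond.\<close>
  proof (rule sum.reindex_bij_witness[where i = "s (g q)" and j = "t q"])
    fix e assume "e \<in> {e \<in> arcs G. g q \<in> fibre K1 (head G e)}"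
    then show "s (g q) e \<in> {e \<in> arcs G. q \<in> fibre K2 (head G e)}"
      using fib[of e "g q"] gT[OF q] fg[OF q] perm[OF gT[OF q]] by (auto simp: permutes_in_image)
  qed (use q t t_arcs fib' in auto)
  \<comment> \<open>Coefficients are pulled back along \<open>g\<close>, vectors along
    \<open>h\<close>.\<close>
  have "correspondence_isomorphism (mw_correspondence G K1 \<phi>1) (mw_correspondence G K2 \<phi>2)
      (\<lambda>a. \<lambda>q\<in>?T2. a (g q)) (\<lambda>\<xi>. \<lambda>z\<in>topspace (edge_space G K2). \<xi> (h z))"
    unfolding correspondence_isomorphism_def
  proof (intro conjI ballI allI)
    show "star_isomorphism (coeff_alg (mw_correspondence G K1 \<phi>1))
        (coeff_alg (mw_correspondence G K2 \<phi>2)) (\<lambda>a. \<lambda>q\<in>?T2. a (g q))"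
      using star_isomorphism_pullback[OF homeo] by (simp add: mw_correspondence_def)
    show "(\<lambda>\<xi>. \<lambda>z\<in>topspace (edge_space G K2). \<xi> (h z)) `
        vec_carrier (mw_correspondence G K1 \<phi>1) = vec_carrier (mw_correspondence G K2 \<phi>2)"
      using bij_betw_imp_surj_on[OF pullback_bij_betw[OF edge]]
      by (simp add: mw_correspondence_def)
  next
    fix a b \<xi>
    show "(\<lambda>z\<in>topspace (edge_space G K2). right_act (mw_correspondence G K1 \<phi>1)
          (left_act (mw_correspondence G K1 \<phi>1) a \<xi>) b (h z)) =
        right_act (mw_correspondence G K2 \<phi>2) (left_act (mw_correspondence G K2 \<phi>2)
          (\<lambda>q\<in>?T2. a (g q)) (\<lambda>z\<in>topspace (edge_space G K2). \<xi> (h z))) (\<lambda>q\<in>?T2. b (g q))"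
    proof (rule ext, goal_cases)
      case (1 z)
      obtain e q where z: "z = (e, q)" by (cases z)
      show ?case
      proof (cases "z \<in> topspace (edge_space G K2)")
        case True
        then have "e \<in> arcs G" "q \<in> fibre K2 (head G e)" by (auto simp: z topspace_edge_space)
        \<comment> \<open>By \<open>emap\<close>, evaluating the pulled-back coefficient
          \<open>a\<close> at the image of \<open>q\<close> under the edge map gives the factor that
          the left action of \<open>a\<close> contributes at \<open>h (e, q)\<close>.\<close>
        with emap T2 have "edge_map G \<phi>2 e q \<in> ?T2" "q \<in> ?T2"
          "g (edge_map G \<phi>2 e q) = edge_map G \<phi>1 (t q e) (g q)" by blast+
        with True hE[OF True] show ?thesis
          by (simp add: mw_correspondence_def z h_def)
      qed (simp add: mw_correspondence_def z)
    qed
  next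
    fix \<xi> \<eta>
    show "inner_prod (mw_correspondence G K2 \<phi>2) (\<lambda>z\<in>topspace (edge_space G K2). \<xi> (h z))
        (\<lambda>z\<in>topspace (edge_space G K2). \<eta> (h z)) =
      (\<lambda>q\<in>?T2. inner_prod (mw_correspondence G K1 \<phi>1) \<xi> \<eta> (g q))"
    proof (rule ext, goal_cases)
      case (1 q)
      show ?case
      proof (cases "q \<in> ?T2")
        case True
        then show ?thesis
          using inner[OF True, of "\<lambda>e. cnj (\<xi> (e, g q)) * \<eta> (e, g q)"] gT[OF True]
          by (simp add: mw_correspondence_def topspace_edge_space h_def)
      qed (simp add: mw_correspondence_def)
    qed
  \<comment> \<open>What remains is additivity and homogeneity: both operations are pointwise, and
    \<open>hE\<close> keeps \<open>h z\<close> inside the space where they are not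
    \<open>undefined\<close>.\<close>
  qed (use hE in \<open>auto simp: mw_correspondence_def fun_eq_iff\<close>)
  then show ?thesis unfolding isomorphic_correspondences_def by blast
qed

section \<open>From the partition to a locally constant field of permutations\<close>

theorem proposition3p1:
  fixes G :: "('v, 'e) pre_digraph"
    and K1 :: "'v \<Rightarrow> 'a metric" and \<phi>1 :: "'e \<Rightarrow> 'a \<Rightarrow> 'a"
    and K2 :: "'v \<Rightarrow> 'b metric" and \<phi>2 :: "'e \<Rightarrow> 'b \<Rightarrow> 'b"
    and f :: "'v \<times> 'a \<Rightarrow> 'v \<times> 'b"
    and m :: nat
    and U :: "nat \<Rightarrow> ('v \<times> 'a) set"
    and \<sigma> :: "nat \<Rightarrow> 'e \<Rightarrow> 'e"
  assumes "mauldin_williams_graph G K1 \<phi>1" and "invariant_list G K1 \<phi>1"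
    and "mauldin_williams_graph G K2 \<phi>2" and "invariant_list G K2 \<phi>2"
    and "homeomorphic_map (total_space G K1) (total_space G K2) f"
    and "partition_on (topspace (total_space G K1)) (U ` {1..m})"
    and "\<forall>j\<in>{1..m}. openin (total_space G K1) (U j)"
    and "\<forall>j\<in>{1..m}. \<sigma> j permutes arcs G"
    and "\<forall>e\<in>arcs G. \<forall>j\<in>{1..m}. f ` fibre K1 (head G e) = fibre K2 (head G (\<sigma> j e))"
    and "\<forall>e\<in>arcs G. \<forall>j\<in>{1..m}. \<forall>p\<in>U j \<inter> fibre K1 (head G e).
           inv_into (topspace (total_space G K1)) f (edge_map G \<phi>2 (\<sigma> j e) (f p)) = edge_map G \<phi>1 e p"
  shows "isomorphic_correspondences (mw_correspondence G K1 \<phi>1) (mw_correspondence G K2 \<phi>2)"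
proof -
  interpret M1: mauldin_williams_graph G K1 \<phi>1 by fact
  interpret M2: mauldin_williams_graph G K2 \<phi>2 by fact
  let ?X = "total_space G K1" and ?Y = "total_space G K2"
  let ?g = "inv_into (topspace ?X) f"
  obtain g where g: "homeomorphic_maps ?X ?Y f g"
    using assms(5) by (auto simp: homeomorphic_map_maps)
  have inj: "inj_on f (topspace ?X)" and img: "f ` topspace ?X = topspace ?Y"
    using assms(5) by (auto simp: homeomorphic_eq_everything_map)
  \<comment> \<open>The conjugacy hypothesis uses \<open>inv_into\<close>, so the continuous inverse
    \<open>g\<close> is traded for it; agreement on \<open>topspace ?Y\<close> is enough.\<close>
  have "?g y = g y" if "y \<in> topspace ?Y" for y
    using g that inj
    by (auto simp: homeomorphic_maps_def intro!: inv_into_f_eq dest: continuous_map_funspace)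
  then have homeo: "homeomorphic_maps ?X ?Y f ?g"
    using g by (auto simp: homeomorphic_maps_def img[symmetric] intro: continuous_map_eq)
  \<comment> \<open>The \<open>U j\<close> need not be distinct, so a point may have several indices; \<open>SOME\<close>
    picks the same one for all points of a part, because they have the same set of indices.\<close>
  define J where "J p = (SOME j. j \<in> {1..m} \<and> p \<in> U j)" for p
  have J: "J p \<in> {1..m} \<and> p \<in> U (J p)" if "p \<in> topspace ?X" for p
  proof -
    have "\<exists>j. j \<in> {1..m} \<and> p \<in> U j" using partition_onD1[OF assms(6)] that by blast
    then show ?thesis unfolding J_def by (rule someI_ex)
  qed
  have J_const: "J q = J p" if "p \<in> topspace ?X" "q \<in> U (J p)" for p q
  proof -
    \<comment> \<open>A partition is a set of sets, so disjointness holds only between distinct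
      parts: a common point forces equal parts, not equal indices.\<close>
    have U_eq: "U i = U j" if "i \<in> {1..m}" "j \<in> {1..m}" "x \<in> U i" "x \<in> U j" for i j x
    proof (rule ccontr)
      assume "U i \<noteq> U j"
      then have "U i \<inter> U j = {}"
        using disjointD[OF partition_onD2[OF assms(6)]] that(1,2) by blast
      with that(3,4) show False by blast
    qed
    have "j \<in> {1..m} \<and> q \<in> U j \<longleftrightarrow> j \<in> {1..m} \<and> p \<in> U j" for j
    \<comment> \<open>An index \<open>j\<close> of either point has \<open>U j = U (J p)\<close>,
      which contains both points; any other \<open>j\<close> makes both sides false.\<close>
    proof (cases "j \<in> {1..m} \<and> (q \<in> U j \<or> p \<in> U j)")
      case True
      then have "U j = U (J p)" using U_eq[of j "J p"] J[OF that(1)] that(2) by blast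
      then show ?thesis using J[OF that(1)] that(2) by blast
    qed blast
    then show ?thesis by (simp add: J_def)
  qed
  show ?thesis
  proof (rule mw_correspondence_isomorphic_twist[where s = "\<lambda>p. \<sigma> (J p)" and f = f and g = ?g])
    show "wf_digraph G" by unfold_locales
    show "homeomorphic_maps ?X ?Y f ?g" by (rule homeo)
    show "\<sigma> (J p) permutes arcs G" if "p \<in> topspace ?X" for p
      using J[OF that] assms(8) by blast
    show "\<exists>W. openin ?X W \<and> p \<in> W \<and> (\<forall>q\<in>W. \<sigma> (J q) = \<sigma> (J p))" if "p \<in> topspace ?X" for p
    proof (intro exI conjI ballI)
      \<comment> \<open>The part chosen for \<open>p\<close> is itself the neighbourhood on which
        the permutation stays fixed.\<close>
      show "openin ?X (U (J p))" "p \<in> U (J p)" using J[OF that] assms(7) by blast+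
      show "\<sigma> (J q) = \<sigma> (J p)" if "q \<in> U (J p)" for q
        by (simp only: J_const[OF \<open>p \<in> topspace ?X\<close> that])
    qed
    show "f p \<in> fibre K2 (head G (\<sigma> (J p) e)) \<longleftrightarrow> p \<in> fibre K1 (head G e)"
      if "e \<in> arcs G" "p \<in> topspace ?X" for e p
    proof -
      have "f ` fibre K1 (head G e) = fibre K2 (head G (\<sigma> (J p) e))"
        using assms(9) J that by blast
      moreover have "fibre K1 (head G e) \<subseteq> topspace ?X"
        using M1.head_in_verts[OF that(1)] unfolding topspace_total_space by blast
      \<comment> \<open>Equality of the image with the fibre yields both directions: injectivity of
        \<open>f\<close> on the whole space excludes points outside the first fibre.\<close>
      ultimately show ?thesis using inj_on_image_mem_iff[OF inj that(2)] by metis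
    qed
    show "\<phi>2 e \<in> mspace (K2 (head G e)) \<rightarrow> mspace (K2 (tail G e))" if "e \<in> arcs G" for e
      using that by (rule M2.edge_map_into)
    show "?g (edge_map G \<phi>2 (\<sigma> (J p) e) (f p)) = edge_map G \<phi>1 e p"
      if "e \<in> arcs G" "p \<in> fibre K1 (head G e)" for e p
    proof -
      have "p \<in> topspace ?X"
        using that M1.head_in_verts[of e] unfolding topspace_total_space by blast
      with J that assms(10) show ?thesis by blast
    qed
  qed
qed

end
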